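(* Let $n\geq 2$, $m\in\{1,\ldots,n\}$ and $N\geq1$ be integers, let $\mathsf V=\{1,\ldots,n\}$ and $\mathsf E=\{(i,j)\in \mathsf V^2 : i\neq j\}$. Let $H$ be a (not necessarily commutative) ring, $K$ a commutative ring, and $\tau:H\to K$ a central morphism of $\mathbb Z$-modules, that is, an additive map such that $\tau(rr')=\tau(r'r)$ for all $r,r'\in H$. For each $(i,j)\in\mathsf E$ let $h_{ij}\in M_N(H)$. Let $\Delta$ be the $n\times n$ matrix of $N\times N$ blocks $$\Delta_{ij}=-h_{ij}a_{ij}\quad\text{for }(i,j)\in\mathsf E,\qquad \Delta_{ii}=\sum_{j\in\mathsf V\setminus\{i\}}a_{ij}I_N\quad\text{for } i\in\mathsf V,$$ seen as an $Nn\times Nn$ matrix with entries in $H[a_{ij}:(i,j)\in\mathsf E]$, and let $\Delta_{[Nm]}$ be the $Nm\times Nm$ matrix obtained from $\Delta$ by erasing the rows and columns of indices greater than $Nm$. Then in the ring $S=K[a_{ij}:(i,j)\in\mathsf E]$ we have $$\det\nolimits_{\tau}\Delta_{[Nm]}=\frac1{N^{Nm}}\sum_{F\in\mathcal F_{m,N}}a_F\prod_{c\in\mathcal C(F)}\bigl(1-N^{\ell(c)}\tau(\hat h_c)\bigr).$$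
   Context: Polynomial rings: $R=H[a_{ij}:(i,j)\in\mathsf E]$ is the polynomial ring over $H$ in $n(n-1)$ indeterminates which commute with each other and with $H$. The map $\tau$ is extended coefficientwise to an additive map $R\to S$, still denoted $\tau$. $\tau$-determinant: for an integer $p\geq1$ and a $p\times p$ matrix $M$ with entries in $R$, $$\det\nolimits_\tau(M)=\sum_{\sigma\in\mathfrak S_p}\varepsilon(\sigma)\prod_{\substack{c\text{ cycle of }\sigma\\ c=(i_1\ldots i_r)}}\tau\bigl(M_{i_1i_2}M_{i_2i_3}\cdots M_{i_ri_1}\bigr)\in S,$$ where $\mathfrak S_p$ is the symmetric group on $p$ elements, $\varepsilon(\sigma)$ is the signature, and fixed points count as cycles of length $1$ (this is well defined because $\tau$ is central). Indexing: the $(N(i-1)+k)$-th row (or column) of $\Delta$ corresponds to the pair $(i,k)$, $i\in\mathsf V$, $k\in\{1,\ldots,N\}$. The graph $\hat{\mathsf G}$: its vertex set is $\mathsf V\times\{1,\ldots,N\}$ and its (directed) edges are all pairs $((i,k),(j,l))$ with $(i,j)\in\mathsf E$ and $(k,l)\in\{1,\ldots,N\}^2$ (so there is no edge with $i=j$). To the edge $((i,k),(j,l))$, going from $(i,k)$ to $(j,l)$, are associated the indeterminate $a_{ij}$ and the element $\hat h_{((i,k),(j,l))}=(h_{ij})_{kl}\in H$, the $(k,l)$ entry of $h_{ij}$. The well of $\hat{\mathsf G}$ is $\{m+1,\ldots,n\}\times\{1,\ldots,N\}$. Forests: $\mathcal F_{m,N}$ is the set of cycle-and-well-rooted spanning forests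 of $\hat{\mathsf G}$, i.e. sets $F$ of edges of $\hat{\mathsf G}$ containing exactly $Nm$ edges, one coming out of each vertex of $\{1,\ldots,m\}\times\{1,\ldots,N\}$. For such $F$, $a_F=\prod_{((i,k),(j,l))\in F}a_{ij}$. Each connected component of $F$ is either a tree rooted at a vertex of the well with edges pointing towards the root, or contains exactly one directed cycle and no vertex of the well; $\mathcal C(F)$ is the (possibly empty) set of these directed cycles. For $c\in\mathcal C(F)$, $\ell(c)$ is its length (number of edges) and $\hat h_c\in H$ is the product, in cyclic order along $c$, of the elements $\hat h_e$ over the edges $e$ of $c$; it depends on the starting point, but $\tau(\hat h_c)$ does not.
   Formalization: The hypothesis τ(1)=1 is added: without it the claim fails (n=2, m=N=1, τ=0 gives 0 = a_12). As 1/N^{Nm} need not exist in K, the identity is stated multiplied by N^{Nm} for every K, and in the literal form whenever N is invertible in K. *)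

theory Defs
  imports
    "HOL-Library.Poly_Mapping"
    "HOL-Combinatorics.Permutations"
    "Jordan_Normal_Form.Matrix"
begin

text \<open>
  All indices are 0-based, as in the matrix library: the vertex set \<open>V\<close> is \<open>{0..<n}\<close>, the well is
  \<open>{m..<n} \<times> {0..<N}\<close>, and the entries of a block are indexed by \<open>{0..<N}\<close>. The pair \<open>(i, k)\<close> corresponds
  to the row (or column) \<open>N * i + k\<close>.
\<close>

text \<open>
  Polynomials are finitely supported functions from monomials to coefficients, with the
  convolution product: the indeterminates commute with each other and with the coefficients.
  There is one indeterminate for every pair of natural numbers; the polynomials below only
  involve the indeterminates \<open>a\<^sub>i\<^sub>j\<close> with \<open>i \<noteq> j\<close> and \<open>i, j < n\<close>, so that an identity between them
  holds in this ring if and only if it holds in its subring generated over the coefficients by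
  these indeterminates.
\<close>

type_synonym 'a arc_poly = "((nat \<times> nat) \<Rightarrow>\<^sub>0 nat) \<Rightarrow>\<^sub>0 'a"

definition const :: "'a::zero \<Rightarrow> 'a arc_poly" where
  "const x = Poly_Mapping.single 0 x"

definition indet :: "nat \<times> nat \<Rightarrow> 'a::zero_neq_one arc_poly" where
  "indet e = Poly_Mapping.single (Poly_Mapping.single e 1) 1"

definition central_morphism :: "('h::ring_1 \<Rightarrow> 'k::comm_ring_1) \<Rightarrow> bool" where
  "central_morphism \<tau> \<longleftrightarrow>
     (\<forall>x y. \<tau> (x + y) = \<tau> x + \<tau> y) \<and> (\<forall>x y. \<tau> (x * y) = \<tau> (y * x))"

definition extend_coeffs :: "('h::ring_1 \<Rightarrow> 'k::comm_ring_1) \<Rightarrow> 'h arc_poly \<Rightarrow> 'k arc_poly" where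
  "extend_coeffs \<tau> = Poly_Mapping.map \<tau>"

text \<open>The edges \<open>(v\<^sub>1, v\<^sub>2), \<dots>, (v\<^sub>r, v\<^sub>1)\<close> in cyclic order, starting from \<open>v\<^sub>1\<close>.\<close>

definition cycle_edges :: "'v list \<Rightarrow> ('v \<times> 'v) list" where
  "cycle_edges vs = zip vs (rotate1 vs)"

definition traverses :: "'v list \<Rightarrow> ('v \<times> 'v) set \<Rightarrow> bool" where
  "traverses vs c \<longleftrightarrow> vs \<noteq> [] \<and> distinct vs \<and> set (cycle_edges vs) = c"

text \<open>
  A directed cycle is identified with its set of edges, which makes it independent of a starting
  point; its length is the cardinality of this set. A loop is a cycle of length 1.
\<close>

definition directed_cycles :: "('v \<times> 'v) set \<Rightarrow> ('v \<times> 'v) set set" where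
  "directed_cycles F = {c. c \<subseteq> F \<and> (\<exists>vs. traverses vs c)}"

text \<open>
  The product of the weights of the edges of \<open>c\<close> in cyclic order, from an arbitrary starting
  point. It is only used as the argument of a central map, whose value does not depend on this
  choice.
\<close>

definition cycle_prod :: "('v \<times> 'v \<Rightarrow> 'r::monoid_mult) \<Rightarrow> ('v \<times> 'v) set \<Rightarrow> 'r" where
  "cycle_prod w c = prod_list (map w (cycle_edges (SOME vs. traverses vs c)))"

text \<open>
  The cycles of a permutation, fixed points included, are the directed cycles of its graph. The
  map \<open>t\<close> is the coefficientwise extension of \<open>\<tau>\<close>, and \<open>M\<close> is assumed to be square.
\<close>

definition det_central ::
    "('r::monoid_mult \<Rightarrow> 's::comm_ring_1) \<Rightarrow> 'r mat \<Rightarrow> 's" where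
  "det_central t M =
     (\<Sum>\<sigma> | \<sigma> permutes {0..<dim_row M}.
        of_int (sign \<sigma>) *
        (\<Prod>c\<in>directed_cycles ((\<lambda>i. (i, \<sigma> i)) ` {0..<dim_row M}). t (cycle_prod (\<lambda>e. M $$ e) c)))"

definition laplacian_block ::
    "nat \<Rightarrow> nat \<Rightarrow> (nat \<Rightarrow> nat \<Rightarrow> 'h::ring_1 mat) \<Rightarrow> nat \<Rightarrow> nat \<Rightarrow> 'h arc_poly mat" where
  "laplacian_block n N h i j =
     (if i = j then (\<Sum>j'\<in>{0..<n} - {i}. indet (i, j')) \<cdot>\<^sub>m 1\<^sub>m N
      else mat N N (\<lambda>kl. - (const (h i j $$ kl) * indet (i, j))))"

definition laplacian ::
    "nat \<Rightarrow> nat \<Rightarrow> (nat \<Rightarrow> nat \<Rightarrow> 'h::ring_1 mat) \<Rightarrow> 'h arc_poly mat" where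
  "laplacian n N h =
     mat (N * n) (N * n)
       (\<lambda>(r, s). laplacian_block n N h (r div N) (s div N) $$ (r mod N, s mod N))"

definition leading_submatrix :: "'r mat \<Rightarrow> nat \<Rightarrow> 'r mat" where
  "leading_submatrix M p = mat p p (\<lambda>rs. M $$ rs)"

type_synonym vert = "nat \<times> nat"

definition hat_edges :: "nat \<Rightarrow> nat \<Rightarrow> (vert \<times> vert) set" where
  "hat_edges n N =
     {((i, k), (j, l)) | i k j l. i < n \<and> j < n \<and> i \<noteq> j \<and> k < N \<and> l < N}"

definition hat_h :: "(nat \<Rightarrow> nat \<Rightarrow> 'h mat) \<Rightarrow> vert \<times> vert \<Rightarrow> 'h" where
  "hat_h h = (\<lambda>((i, k), (j, l)). h i j $$ (k, l))"

definition forests :: "nat \<Rightarrow> nat \<Rightarrow> nat \<Rightarrow> (vert \<times> vert) set set" where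
  "forests n m N =
     {F. F \<subseteq> hat_edges n N \<and> card F = N * m \<and>
         (\<forall>v \<in> {0..<m} \<times> {0..<N}. \<exists>!e. e \<in> F \<and> fst e = v)}"

definition forest_monomial :: "(vert \<times> vert) set \<Rightarrow> 'k::comm_ring_1 arc_poly" where
  "forest_monomial F = (\<Prod>((i, k), (j, l))\<in>F. indet (i, j))"

end

theory Submission
  imports Defs "HOL-Combinatorics.Cycles"
begin

text \<open>
  Write \<open>V\<close> for the \<open>N * m\<close> vertices outside the well. A forest is the choice of one edge out of each
  vertex of \<open>V\<close>, that is the graph of a function \<open>f\<close>
  (\<open>bij_betw_functions_forests\<close>). Expanding the factors \<open>1 - N\<^sup>r \<tau>(h\<^sub>c)\<close> over the cycles of this graph,
  where \<open>r\<close> is the length of \<open>c\<close>, amounts to selecting some of these cycles; the selected cycles are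
  the nontrivial cycles of a permutation \<open>\<sigma>\<close> of \<open>V\<close> that follows \<open>f\<close> at the points which it moves
  (\<open>prod_cycles_expand\<close>).

  The forest sum thus becomes a sum over pairs \<open>(f, \<sigma>)\<close>, and one sums over \<open>f\<close> first, for a given \<open>\<sigma>\<close>
  (\<open>sum_functions_eq_sum_permutations\<close>). At a moved point the value of \<open>f\<close> is prescribed; at a fixed
  point it is free and yields the sum of the indeterminates of all outgoing edges. Therefore \<open>\<sigma>\<close>
  contributes a factor \<open>- N\<^sup>r \<tau>(h\<^sub>c) a\<^sub>c\<close> for each nontrivial cycle \<open>c\<close>, and \<open>N\<close> times a diagonal entry of
  the Laplacian for each fixed point (\<open>extend_coeffs_laplacian_diagonal\<close>).

  This is the term of \<open>\<sigma>\<close> in the determinant, multiplied by \<open>N\<close> once for each vertex of \<open>V\<close>. Indeed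
  the signature is the product of \<open>(- 1) ^ (r - 1)\<close> over the cycles (\<open>sign_directed_cycles\<close>), and
  together with the minus signs of the off-diagonal entries it leaves one minus sign per
  nontrivial cycle (\<open>extend_coeffs_cycle_prod\<close>). Centrality of \<open>\<tau>\<close> intervenes through
  \<open>cycle_prod_traverses\<close>: it allows the cycles of row numbers and those of vertices to be
  traversed from different starting points.
\<close>

section \<open>Directed cycles in functional graphs\<close>

lemma traverses_nth:
  assumes "traverses vs c"
  shows "c = (\<lambda>i. (vs ! i, vs ! (Suc i mod length vs))) ` {..<length vs}"
proof -
  have "c = set (zip vs (rotate1 vs))"
    using assms by (simp add: traverses_def cycle_edges_def)
  also have "\<dots> = (\<lambda>i. (vs ! i, rotate1 vs ! i)) ` {..<length vs}"
    by (auto simp: set_zip)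
  also have "\<dots> = (\<lambda>i. (vs ! i, vs ! (Suc i mod length vs))) ` {..<length vs}"
    by (intro image_cong) (auto simp: nth_rotate1)
  finally show ?thesis .
qed

lemma traverses_edges:
  assumes "traverses vs c"
  shows "length (cycle_edges vs) = card c" and "distinct (cycle_edges vs)" and "set (cycle_edges vs) = c"
    and "finite c" and "card c > 0"
proof -
  show d: "distinct (cycle_edges vs)"
    using assms by (simp add: traverses_def cycle_edges_def distinct_zipI1)
  show s: "set (cycle_edges vs) = c"
    using assms by (simp add: traverses_def)
  show l: "length (cycle_edges vs) = card c"
    using d s distinct_card by fastforce
  show "finite c"
    using s by auto
  show "card c > 0"
    using assms l by (simp add: traverses_def cycle_edges_def flip: l)
qed

lemma traverses_Domain: "traverses vs c \<Longrightarrow> Domain c = set vs"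
  and traverses_Range: "traverses vs c \<Longrightarrow> Range c = set vs"
proof -
  assume t: "traverses vs c"
  then have c: "c = set (zip vs (rotate1 vs))"
    by (simp add: traverses_def cycle_edges_def)
  show "Domain c = set vs"
    by (metis c Domain_fst length_rotate1 map_fst_zip set_map)
  show "Range c = set vs"
    by (metis c Range_snd length_rotate1 map_snd_zip set_map set_rotate1)
qed

text \<open>
  A directed cycle is strongly connected: walking around it from \<open>x\<close> one meets \<open>y\<close>.
\<close>

lemma traverses_induct:
  assumes t: "traverses vs c" and x: "x \<in> set vs" "P x"
    and step: "\<And>u v. (u, v) \<in> c \<Longrightarrow> P u \<Longrightarrow> P v"
    and y: "y \<in> set vs"
  shows "P y"
proof -
  let ?n = "length vs"
  obtain i j where i: "i < ?n" "x = vs ! i" and j: "j < ?n" "y = vs ! j"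
    using x y by (metis in_set_conv_nth)
  have "P (vs ! ((i + k) mod ?n))" for k
  proof (induction k)
    case 0
    show ?case using i x by simp
  next
    case (Suc k)
    have "(i + k) mod ?n < ?n" using i by (intro mod_less_divisor) linarith
    then have "(vs ! ((i + k) mod ?n), vs ! (Suc ((i + k) mod ?n) mod ?n)) \<in> c"
      by (subst traverses_nth[OF t]) blast
    then show ?case
      using step Suc by (simp add: mod_Suc_eq)
  qed
  from this[of "j + (?n - i)"] show ?thesis
    using i j by simp
qed

text \<open>
  When every vertex has at most one outgoing edge, a walk has no choice: starting from a common
  vertex, each of the two cycles is forced to follow the other one.
\<close>

lemma directed_cycles_eqI:
  assumes F: "single_valued F"
    and c: "c \<in> directed_cycles F" and d: "d \<in> directed_cycles F"
    and x: "x \<in> Domain c" "x \<in> Domain d"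
  shows "c = d"
proof -
  have sub: "d \<subseteq> c"
    if c: "c \<in> directed_cycles F" and d: "d \<in> directed_cycles F"
      and x: "x \<in> Domain c" "x \<in> Domain d" for c d
  proof -
    from c d obtain vs ws where v: "traverses vs c" "c \<subseteq> F" and w: "traverses ws d" "d \<subseteq> F"
      by (auto simp: directed_cycles_def)
    have step: "(u, u') \<in> c" if "(u, u') \<in> d" "u \<in> Domain c" for u u'
      using that v(2) w(2) F by (metis DomainE single_valuedD subsetD)
    have D: "y \<in> Domain c" if "y \<in> Domain d" for y
    proof (rule traverses_induct[OF w(1), of x])
      show "x \<in> set ws" "y \<in> set ws"
        using x that traverses_Domain[OF w(1)] by auto
      show "\<And>u v. (u, v) \<in> d \<Longrightarrow> u \<in> Domain c \<Longrightarrow> v \<in> Domain c"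
        using step traverses_Domain[OF v(1)] traverses_Range[OF v(1)] by blast
    qed (rule x)
    show ?thesis
      using step D by (meson DomainI subrelI)
  qed
  show ?thesis
    using sub[OF c d x] sub[OF d c x(2,1)] by blast
qed

text \<open>
  No new cycle appears in a union of cycles of a functional graph, because it would share an edge
  with one of them. Hence a set of cycles can be recovered from its union.
\<close>

lemma directed_cycles_Union:
  assumes F: "single_valued F" and C: "C \<subseteq> directed_cycles F"
  shows "directed_cycles (\<Union>C) = C"
proof
  have U: "\<Union>C \<subseteq> F"
    using C by (auto simp: directed_cycles_def)
  show "directed_cycles (\<Union>C) \<subseteq> C"
  proof
    fix c assume c: "c \<in> directed_cycles (\<Union>C)"
    then obtain vs where v: "traverses vs c" "c \<subseteq> \<Union>C"
      by (auto simp: directed_cycles_def)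
    then obtain x y where "(x, y) \<in> c"
      using traverses_edges[OF v(1)] by (metis card_gt_0_iff ex_in_conv surj_pair)
    then obtain d where d: "d \<in> C" "(x, y) \<in> d" "(x, y) \<in> c"
      using v by blast
    have "c \<in> directed_cycles F"
      using v U by (auto simp: directed_cycles_def)
    then have "c = d"
      using directed_cycles_eqI[OF F] d C by blast
    with d show "c \<in> C" by simp
  qed
  show "C \<subseteq> directed_cycles (\<Union>C)"
    using C by (auto simp: directed_cycles_def)
qed

lemma directed_cycles_mono: "F \<subseteq> G \<Longrightarrow> directed_cycles F \<subseteq> directed_cycles G"
  by (auto simp: directed_cycles_def)

lemma finite_directed_cycles: "finite F \<Longrightarrow> finite (directed_cycles F)"
  by (rule finite_subset[of _ "Pow F"]) (auto simp: directed_cycles_def)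

lemma directed_cycles_disjoint:
  assumes "single_valued F" "c \<in> directed_cycles F" "d \<in> directed_cycles F" "c \<noteq> d"
  shows "c \<inter> d = {}"
proof (rule ccontr)
  assume "c \<inter> d \<noteq> {}"
  then obtain x y where "(x, y) \<in> c" "(x, y) \<in> d" by auto
  then show False
    using directed_cycles_eqI[OF assms(1-3), of x] assms(4) by blast
qed

lemma cycle_edges_map: "cycle_edges (map f vs) = map (map_prod f f) (cycle_edges vs)"
  by (simp add: cycle_edges_def rotate1_map zip_map_map map_prod_def)

lemma traverses_map:
  assumes "inj \<phi>" "traverses vs c"
  shows "traverses (map \<phi> vs) (map_prod \<phi> \<phi> ` c)"
  using assms by (auto simp: traverses_def cycle_edges_map distinct_map inj_def inj_on_def)

lemma directed_cycles_map:
  assumes "inj \<phi>"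
  shows "directed_cycles (map_prod \<phi> \<phi> ` F) = (`) (map_prod \<phi> \<phi>) ` directed_cycles F"
proof
  show "(`) (map_prod \<phi> \<phi>) ` directed_cycles F \<subseteq> directed_cycles (map_prod \<phi> \<phi> ` F)"
    using traverses_map[OF assms] by (fastforce simp: directed_cycles_def)
  show "directed_cycles (map_prod \<phi> \<phi> ` F) \<subseteq> (`) (map_prod \<phi> \<phi>) ` directed_cycles F"
  proof
    fix c assume "c \<in> directed_cycles (map_prod \<phi> \<phi> ` F)"
    then obtain vs where v: "traverses vs c" "c \<subseteq> map_prod \<phi> \<phi> ` F"
      by (auto simp: directed_cycles_def)
    then obtain d where d: "d \<subseteq> F" "c = map_prod \<phi> \<phi> ` d"
      by (meson subset_imageE)
    have "set vs = \<phi> ` Domain d"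
      using traverses_Domain[OF v(1)] d(2) by (force simp: map_prod_def)
    then obtain ws where ws: "vs = map \<phi> ws"
      by (metis ex_map_conv imageE)
    have "map_prod \<phi> \<phi> ` set (cycle_edges ws) = map_prod \<phi> \<phi> ` d"
      using v(1) d(2) ws by (simp add: traverses_def cycle_edges_map)
    then have "set (cycle_edges ws) = d"
      using assms by (simp add: inj_image_eq_iff prod.inj_map)
    then have "traverses ws d"
      using v(1) ws by (auto simp: traverses_def distinct_map)
    then show "c \<in> (`) (map_prod \<phi> \<phi>) ` directed_cycles F"
      using d by (auto simp: directed_cycles_def)
  qed
qed

section \<open>Products along a cycle\<close>

lemma cycle_edges_rotate: "cycle_edges (rotate k vs) = rotate k (cycle_edges vs)"
proof (induction k)
  case (Suc k)
  have "cycle_edges (rotate1 us) = rotate1 (cycle_edges us)" for us :: "'a list"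
  proof (rule nth_equalityI)
    fix i assume "i < length (cycle_edges (rotate1 us))"
    then have "i < length us" by (simp add: cycle_edges_def)
    moreover from this have "Suc i mod length us < length us"
      by (intro mod_less_divisor) linarith
    ultimately show "cycle_edges (rotate1 us) ! i = rotate1 (cycle_edges us) ! i"
      by (simp add: cycle_edges_def nth_rotate1)
  qed (simp add: cycle_edges_def)
  then show ?case using Suc by simp
qed simp

lemma traverses_rotate:
  assumes "traverses vs c"
  shows "traverses (rotate k vs) c"
  using assms by (simp add: traverses_def cycle_edges_rotate)

lemma traverses_unique:
  assumes v: "traverses vs c" and w: "traverses ws c" and hd: "hd vs = hd ws"
  shows "vs = ws"
proof -
  have l: "length vs = length ws"
    using traverses_edges(1)[OF v] traverses_edges(1)[OF w] by (simp add: cycle_edges_def)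
  have c: "(us ! i, us ! Suc i) \<in> c" if "traverses us c" "Suc i < length us" for i us
    using that by (subst traverses_nth[OF that(1)]) (auto intro!: image_eqI[of _ _ i])
  have inj: "y = z" if "(x, y) \<in> c" "(x, z) \<in> c" for x y z
  proof -
    have "distinct (map fst (cycle_edges vs))" "set (cycle_edges vs) = c"
      using v by (simp_all add: traverses_def cycle_edges_def)
    then show ?thesis
      using that by (metis eq_key_imp_eq_value)
  qed
  have "vs ! i = ws ! i" if "i < length vs" for i
    using that
  proof (induction i)
    case 0
    then show ?case using hd l by (metis hd_conv_nth length_0_conv less_nat_zero_code)
  next
    case (Suc i)
    then show ?case using c[OF v, of i] c[OF w, of i] l inj by simp
  qed
  then show ?thesis using l by (simp add: nth_equalityI)
qed

text \<open>
  Two traversals of the same cycle differ by a rotation, so that the products of the weights are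
  of the form \<open>x * y\<close> and \<open>y * x\<close>, which a central map does not distinguish.
\<close>

lemma cycle_prod_traverses:
  assumes central: "\<And>x y. t (x * y) = t (y * x)" and v: "traverses vs c"
  shows "t (cycle_prod w c) = t (prod_list (map w (cycle_edges vs)))"
proof -
  define ws where "ws = (SOME vs. traverses vs c)"
  have w: "traverses ws c"
    unfolding ws_def using v by (rule someI)
  have "hd vs \<in> set ws"
    using traverses_Domain[OF v] traverses_Domain[OF w] v by (simp add: traverses_def)
  then obtain k where k: "k < length ws" "ws ! k = hd vs"
    by (metis in_set_conv_nth)
  have "rotate k ws = vs"
  proof (rule traverses_unique[OF traverses_rotate[OF w] v])
    show "hd (rotate k ws) = hd vs"
      using k w by (simp add: hd_rotate_conv_nth traverses_def)
  qed
  then have "cycle_edges vs = rotate k (cycle_edges ws)"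
    using cycle_edges_rotate by metis
  then obtain xs ys where "cycle_edges ws = xs @ ys" "cycle_edges vs = ys @ xs"
    by (metis append_take_drop_id rotate_drop_take)
  then show ?thesis
    unfolding cycle_prod_def ws_def[symmetric] by (simp add: central)
qed

section \<open>The cycles of a permutation\<close>

text \<open>
  The graph of \<open>\<sigma>\<close> without its loops. The fixed points are left out because in the determinant they
  select diagonal entries, whereas only the longer cycles of a permutation are cycles of a forest.
\<close>

definition moved :: "('v \<Rightarrow> 'v) \<Rightarrow> ('v \<times> 'v) set" where
  "moved \<sigma> = {(v, \<sigma> v) | v. \<sigma> v \<noteq> v}"

lemma single_valued_moved: "single_valued (moved \<sigma>)"
  by (auto simp: moved_def single_valued_def)

text \<open>
  The cycle decomposition of a permutation: the edge leaving a moved point \<open>v\<close> lies on the orbit of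
  \<open>v\<close>, which closes up at the least power of \<open>\<sigma>\<close> that fixes \<open>v\<close>.
\<close>

lemma Union_directed_cycles_moved:
  assumes "permutation \<sigma>"
  shows "\<Union>(directed_cycles (moved \<sigma>)) = moved \<sigma>"
proof
  show "\<Union>(directed_cycles (moved \<sigma>)) \<subseteq> moved \<sigma>"
    by (auto simp: directed_cycles_def)
  show "moved \<sigma> \<subseteq> \<Union>(directed_cycles (moved \<sigma>))"
  proof
    fix e assume "e \<in> moved \<sigma>"
    then obtain v where e: "e = (v, \<sigma> v)" "\<sigma> v \<noteq> v"
      by (auto simp: moved_def)
    define vs where "vs = support \<sigma> v"
    let ?n = "least_power \<sigma> v"
    have n: "?n > 0" "(\<sigma> ^^ ?n) v = v"
      using least_power_of_permutation[OF assms] by auto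
    have rot: "rotate1 vs = map \<sigma> vs"
    proof (rule nth_equalityI)
      fix i assume "i < length (rotate1 vs)"
      then have i: "i < ?n" by (simp add: vs_def)
      show "rotate1 vs ! i = map \<sigma> vs ! i"
      proof (cases "Suc i = ?n")
        case True
        have "rotate1 vs ! i = v"
          using i True n by (simp add: vs_def nth_rotate1)
        also have "v = \<sigma> ((\<sigma> ^^ i) v)"
          using n True by (metis comp_apply funpow.simps(2))
        finally show ?thesis using i by (simp add: vs_def)
      qed (use i in \<open>simp add: vs_def nth_rotate1\<close>)
    qed (simp add: vs_def)
    have inj: "inj (\<sigma> ^^ i)" for i
      using assms by (simp add: bij_is_inj permutation_bijective inj_fn)
    have "\<sigma> ((\<sigma> ^^ i) v) \<noteq> (\<sigma> ^^ i) v" for i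
      using e(2) injD[OF inj] by (metis funpow_swap1)
    then have "set (cycle_edges vs) \<subseteq> moved \<sigma>"
      unfolding cycle_edges_def rot by (auto simp: set_zip vs_def moved_def)
    moreover have "traverses vs (set (cycle_edges vs))"
      using n cycle_of_permutation[OF assms, of v] by (simp add: traverses_def vs_def)
    moreover have "e \<in> set (cycle_edges vs)"
      unfolding cycle_edges_def rot e using n by (force simp: set_zip vs_def intro!: exI[of _ 0])
    ultimately show "e \<in> \<Union>(directed_cycles (moved \<sigma>))"
      by (auto simp: directed_cycles_def)
  qed
qed

lemma prod_directed_cycles:
  assumes "permutation \<sigma>"
  shows "(\<Prod>v | \<sigma> v \<noteq> v. g (v, \<sigma> v)) = (\<Prod>c\<in>directed_cycles (moved \<sigma>). \<Prod>e\<in>c. g e)"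
proof -
  have "(\<Prod>v | \<sigma> v \<noteq> v. g (v, \<sigma> v)) = (\<Prod>e\<in>moved \<sigma>. g e)"
    by (rule prod.reindex_bij_witness[of _ fst "\<lambda>v. (v, \<sigma> v)"]) (auto simp: moved_def)
  also have "moved \<sigma> = \<Union>(directed_cycles (moved \<sigma>))"
    using Union_directed_cycles_moved[OF assms] by simp
  also have "(\<Prod>e\<in>\<dots>. g e) = (\<Prod>c\<in>directed_cycles (moved \<sigma>). \<Prod>e\<in>c. g e)"
  proof (subst prod.Union_disjoint)
    show "\<forall>A\<in>directed_cycles (moved \<sigma>). finite A"
      using traverses_edges(4) by (auto simp: directed_cycles_def)
    show "\<forall>A\<in>directed_cycles (moved \<sigma>). \<forall>B\<in>directed_cycles (moved \<sigma>). A \<noteq> B \<longrightarrow> A \<inter> B = {}"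
      using directed_cycles_disjoint[OF single_valued_moved] by blast
  qed simp
  finally show ?thesis .
qed

lemma sign_cycle_of_list:
  assumes "distinct vs" "vs \<noteq> []"
  shows "sign (cycle_of_list vs) = (- 1) ^ (length vs - 1)"
  using assms
proof (induction vs rule: cycle_of_list.induct)
  case (1 i j cs)
  have "sign (cycle_of_list (i # j # cs)) = sign (Transposition.transpose i j) * sign (cycle_of_list (j # cs))"
    unfolding cycle_of_list.simps by (intro sign_compose permutation_of_cycle permutation_swap_id)
  then show ?case
    using 1 by (simp add: sign_swap_id del: cycle_of_list.simps)
qed auto

text \<open>
  This links cycles as sets of edges with the library's cyclic permutations, whose sign is easily
  computed from transpositions.
\<close>

lemma restrict_id_cycle:
  assumes t: "traverses vs c" and f: "\<And>u v. (u, v) \<in> c \<Longrightarrow> v = f u"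
  shows "restrict_id f (Domain c) = cycle_of_list vs"
proof
  fix x
  show "restrict_id f (Domain c) x = cycle_of_list vs x"
  proof (cases "x \<in> set vs")
    case True
    then obtain i where i: "i < length vs" "x = vs ! i"
      by (metis in_set_conv_nth)
    have "map (cycle_of_list vs) vs = rotate1 vs"
      using cyclic_rotation[of vs 1] t by (simp add: traverses_def)
    then have "cycle_of_list vs x = rotate1 vs ! i"
      using i by (metis nth_map)
    moreover have "(x, rotate1 vs ! i) \<in> c"
      using t i by (auto simp: traverses_def cycle_edges_def set_zip)
    ultimately show ?thesis
      using f True traverses_Domain[OF t] by simp
  next
    case False
    then show ?thesis
      using id_outside_supp[OF False] traverses_Domain[OF t] by simp
  qed
qed

text \<open>
  The permutation that follows \<open>f\<close> along a set of disjoint cycles is the composition of the cyclic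
  permutations of these cycles; the sign is multiplicative.
\<close>

lemma sign_restrict_id_cycles:
  assumes F: "single_valued F" and f: "\<And>u v. (u, v) \<in> F \<Longrightarrow> v = f u"
    and C: "finite C" "C \<subseteq> directed_cycles F"
  shows "permutation (restrict_id f (Domain (\<Union>C))) \<and>
    sign (restrict_id f (Domain (\<Union>C))) = (\<Prod>c\<in>C. (- 1) ^ (card c - 1))"
  using C
proof (induction C rule: finite_induct)
  case empty
  have "restrict_id f (Domain (\<Union>{})) = id"
    by (auto simp: restrict_id_def)
  then show ?case by simp
next
  case (insert c C)
  then obtain vs where v: "traverses vs c" "c \<subseteq> F"
    by (auto simp: directed_cycles_def)
  have c: "restrict_id f (Domain c) = cycle_of_list vs"
    using restrict_id_cycle[OF v(1)] f v(2) by blast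
  have disj: "Domain c \<inter> Domain (\<Union>C) = {}"
    using directed_cycles_eqI[OF F] insert by (fastforce simp: Domain_Union)
  have fc: "f x \<in> Domain c" if "x \<in> Domain c" for x
    using that f v traverses_Domain[OF v(1)] traverses_Range[OF v(1)] by (metis DomainE Range.intros subsetD)
  have "restrict_id f (Domain (\<Union>(insert c C))) = restrict_id f (Domain (\<Union>C)) \<circ> cycle_of_list vs"
  proof
    fix x
    show "restrict_id f (Domain (\<Union>(insert c C))) x = (restrict_id f (Domain (\<Union>C)) \<circ> cycle_of_list vs) x"
    proof (cases "x \<in> Domain c")
      case True
      then have "f x \<notin> Domain (\<Union>C)" using disj fc by blast
      then show ?thesis using True by (simp add: c[symmetric] Domain_Un_eq)
    next
      case False
      then show ?thesis by (simp add: c[symmetric] Domain_Un_eq restrict_id_def)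
    qed
  qed
  moreover have "sign (cycle_of_list vs) = (- 1) ^ (card c - 1)"
    using sign_cycle_of_list[of vs] v(1) traverses_edges(1)[OF v(1)]
    by (simp add: traverses_def cycle_edges_def)
  moreover have "permutation (restrict_id f (Domain (\<Union>C)))"
    and "sign (restrict_id f (Domain (\<Union>C))) = (\<Prod>c\<in>C. (- 1) ^ (card c - 1))"
    using insert by auto
  ultimately show ?case
    using insert(1,2) by (simp only: sign_compose permutation_compose permutation_of_cycle prod.insert mult.commute simp_thms)
qed

lemma sign_directed_cycles:
  assumes "permutation \<sigma>"
  shows "sign \<sigma> = (\<Prod>c\<in>directed_cycles (moved \<sigma>). (- 1) ^ (card c - 1))"
proof -
  have "finite (directed_cycles (moved \<sigma>))"
    using assms by (intro finite_directed_cycles) (simp add: moved_def setcompr_eq_image permutation)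
  moreover have "restrict_id \<sigma> (Domain (moved \<sigma>)) = \<sigma>"
    by (auto simp: restrict_id_def moved_def fun_eq_iff)
  ultimately show ?thesis
    using sign_restrict_id_cycles[OF single_valued_moved[of \<sigma>], of \<sigma> "directed_cycles (moved \<sigma>)"]
    unfolding Union_directed_cycles_moved[OF assms] by (auto simp: moved_def)
qed

section \<open>Choices of outgoing edges\<close>

text \<open>
  Expanding the product selects a subset of the cycles of the functional graph of \<open>f\<close>. Such a subset
  is the same thing as a permutation which at every vertex either follows \<open>f\<close> or stays in place:
  the permutation follows \<open>f\<close> on the selected cycles, and conversely the selected cycles are its
  nontrivial ones. As \<open>f\<close> has no fixed point in \<open>V\<close>, a cycle of \<open>f\<close> is never a loop, so that it
  can be told whether it has been selected.
\<close>

lemma prod_cycles_expand: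
  fixes w :: "('v \<times> 'v) set \<Rightarrow> 's::comm_ring_1"
  assumes V: "finite V" and loopless: "\<And>v. v \<in> V \<Longrightarrow> f v \<noteq> v"
  shows "(\<Prod>c\<in>directed_cycles ((\<lambda>v. (v, f v)) ` V). 1 + w c) =
    (\<Sum>\<sigma> | \<sigma> permutes V \<and> (\<forall>v\<in>V. \<sigma> v = v \<or> \<sigma> v = f v). \<Prod>c\<in>directed_cycles (moved \<sigma>). w c)"
proof -
  define F where "F = (\<lambda>v. (v, f v)) ` V"
  have sv: "single_valued F"
    by (auto simp: F_def single_valued_def)
  have fin: "finite (directed_cycles F)"
    using V by (simp add: F_def finite_directed_cycles)
  have A: "Domain (\<Union>C) \<subseteq> V" "moved (restrict_id f (Domain (\<Union>C))) = \<Union>C"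
    "restrict_id f (Domain (\<Union>C)) permutes V" if C: "C \<subseteq> directed_cycles F" for C
  proof -
    let ?A = "Domain (\<Union>C)"
    have CF: "\<Union>C \<subseteq> F"
      using C by (auto simp: directed_cycles_def)
    then show AV: "?A \<subseteq> V"
      by (auto simp: F_def)
    have e: "y = f x" if "(x, y) \<in> \<Union>C" for x y
      using CF that by (auto simp: F_def)
    have "(v, f v) \<in> \<Union>C" if "v \<in> ?A" for v
      using that e by blast
    then show "moved (restrict_id f ?A) = \<Union>C"
      using e loopless AV by (fastforce simp: moved_def restrict_id_def)
    have "f ` ?A = Range (\<Union>C)"
      using e by force
    also have "\<dots> = ?A"
    proof -
      have "Range c = Domain c" if c: "c \<in> C" for c
      proof -
        obtain vs where "traverses vs c"
          using c C by (auto simp: directed_cycles_def)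
        then show ?thesis by (simp add: traverses_Domain traverses_Range)
      qed
      then show ?thesis by (simp add: Range_Union Domain_Union)
    qed
    finally have "f ` ?A = ?A" .
    \<comment> \<open>A surjection of a finite set onto itself is a bijection.\<close>
    moreover from this have "inj_on f ?A"
      using AV V by (simp add: eq_card_imp_inj_on finite_subset)
    ultimately have "restrict_id f ?A permutes ?A"
      by (intro permutes_restrict_id) (simp add: bij_betw_def)
    then show "restrict_id f ?A permutes V"
      using AV by (rule permutes_subset)
  qed
  have "(\<Prod>c\<in>directed_cycles F. 1 + w c) = (\<Sum>C\<in>Pow (directed_cycles F). \<Prod>c\<in>C. w c)"
    using prod_add[OF fin, of w "\<lambda>_. 1"] by (simp add: add.commute)
  also have "\<dots> = (\<Sum>\<sigma> | \<sigma> permutes V \<and> (\<forall>v\<in>V. \<sigma> v = v \<or> \<sigma> v = f v). \<Prod>c\<in>directed_cycles (moved \<sigma>). w c)"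
  proof (rule sum.reindex_bij_witness[where j = "\<lambda>C. restrict_id f (Domain (\<Union>C))"
        and i = "\<lambda>\<sigma>. directed_cycles (moved \<sigma>)"])
    fix C assume "C \<in> Pow (directed_cycles F)"
    then have C: "C \<subseteq> directed_cycles F" by simp
    show inv: "directed_cycles (moved (restrict_id f (Domain (\<Union>C)))) = C"
      using A(2)[OF C] directed_cycles_Union[OF sv C] by simp
    show "restrict_id f (Domain (\<Union>C)) \<in> {\<sigma>. \<sigma> permutes V \<and> (\<forall>v\<in>V. \<sigma> v = v \<or> \<sigma> v = f v)}"
      using A(3)[OF C] by (simp add: restrict_id_def)
    show "prod w (directed_cycles (moved (restrict_id f (Domain (\<Union>C))))) = prod w C"
      using inv by simp
  next
    fix \<sigma> assume "\<sigma> \<in> {\<sigma>. \<sigma> permutes V \<and> (\<forall>v\<in>V. \<sigma> v = v \<or> \<sigma> v = f v)}"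
    then have s: "\<sigma> permutes V" "\<And>v. \<sigma> v \<noteq> v \<Longrightarrow> v \<in> V \<and> \<sigma> v = f v"
      by (auto simp: permutes_def)
    have "moved \<sigma> \<subseteq> F"
      using s(2) by (auto simp: moved_def F_def)
    then show "directed_cycles (moved \<sigma>) \<in> Pow (directed_cycles F)"
      using directed_cycles_mono by auto
    have "restrict_id f (Domain (moved \<sigma>)) = \<sigma>"
      using s(2) by (auto simp: restrict_id_def moved_def fun_eq_iff)
    then show "restrict_id f (Domain (\<Union>(directed_cycles (moved \<sigma>)))) = \<sigma>"
      using Union_directed_cycles_moved[OF permutes_imp_permutation[OF V s(1)]] by simp
  qed
  finally show ?thesis unfolding F_def .
qed

lemma prod_moved_fixed:
  assumes "\<sigma> permutes V" "finite V"
  shows "(\<Prod>v\<in>V. g v) = (\<Prod>v | \<sigma> v \<noteq> v. g v) * (\<Prod>v | v \<in> V \<and> \<sigma> v = v. g v)"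
proof -
  have "{v. \<sigma> v \<noteq> v} \<subseteq> V"
    using permutes_not_in[OF assms(1)] by blast
  then have "V = {v. \<sigma> v \<noteq> v} \<union> {v. v \<in> V \<and> \<sigma> v = v}" "finite {v. \<sigma> v \<noteq> v}"
    using assms(2) by (auto intro: finite_subset)
  then show ?thesis
    using assms(2) by (metis (no_types, lifting) prod.union_disjoint disjoint_iff finite_Un mem_Collect_eq)
qed

text \<open>
  The exchange of summations on which the theorem rests. On the left, a function \<open>f\<close> is a choice of
  one edge out of each vertex of \<open>V\<close>. After expanding the product over cycles by
  \<open>prod_cycles_expand\<close>, the sum runs over the pairs \<open>(f, \<sigma>)\<close> such that \<open>\<sigma>\<close> follows \<open>f\<close> wherever it
  moves. For a fixed permutation \<open>\<sigma>\<close> the edge is then prescribed at the moved vertices and free at the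
  fixed ones, so that the sum over \<open>f\<close> is a product of sums over the vertices. The value \<open>0\<close> takes
  care of the permutations that move a vertex along a pair which is not an edge: no \<open>f\<close> is
  compatible with them.
\<close>

lemma sum_functions_eq_sum_permutations:
  fixes a :: "'v \<times> 'v \<Rightarrow> 's::comm_ring_1"
  assumes V: "finite V" and out: "\<And>v. v \<in> V \<Longrightarrow> finite (out v)" "\<And>v. v \<in> V \<Longrightarrow> v \<notin> out v"
  shows "(\<Sum>f\<in>PiE V out. (\<Prod>v\<in>V. a (v, f v)) * (\<Prod>c\<in>directed_cycles ((\<lambda>v. (v, f v)) ` V). 1 + w c)) =
    (\<Sum>\<sigma> | \<sigma> permutes V.
      (\<Prod>c\<in>directed_cycles (moved \<sigma>). w c * (\<Prod>e\<in>c. if snd e \<in> out (fst e) then a e else 0)) *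
      (\<Prod>v | v \<in> V \<and> \<sigma> v = v. \<Sum>x\<in>out v. a (v, x)))"
proof -
  let ?P = "{\<sigma>. \<sigma> permutes V}"
  let ?W = "\<lambda>\<sigma>. \<Prod>c\<in>directed_cycles (moved \<sigma>). w c"
  have "(\<Sum>f\<in>PiE V out. (\<Prod>v\<in>V. a (v, f v)) * (\<Prod>c\<in>directed_cycles ((\<lambda>v. (v, f v)) ` V). 1 + w c)) =
    (\<Sum>f\<in>PiE V out. \<Sum>\<sigma>\<in>{\<sigma>\<in>?P. \<forall>v\<in>V. \<sigma> v = v \<or> \<sigma> v = f v}. ?W \<sigma> * (\<Prod>v\<in>V. a (v, f v)))"
  proof (rule sum.cong[OF refl])
    fix f assume "f \<in> PiE V out"
    then have "f v \<noteq> v" if "v \<in> V" for v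
      using out(2)[OF that] that by (metis PiE_mem)
    then show "(\<Prod>v\<in>V. a (v, f v)) * (\<Prod>c\<in>directed_cycles ((\<lambda>v. (v, f v)) ` V). 1 + w c) =
      (\<Sum>\<sigma>\<in>{\<sigma>\<in>?P. \<forall>v\<in>V. \<sigma> v = v \<or> \<sigma> v = f v}. ?W \<sigma> * (\<Prod>v\<in>V. a (v, f v)))"
      using prod_cycles_expand[OF V, of f w] by (simp add: sum_distrib_left mult.commute)
  qed
  also have "\<dots> = (\<Sum>\<sigma>\<in>?P. \<Sum>f\<in>{f\<in>PiE V out. \<forall>v\<in>V. \<sigma> v = v \<or> \<sigma> v = f v}. ?W \<sigma> * (\<Prod>v\<in>V. a (v, f v)))"
    using V out by (intro sum.swap_restrict finite_PiE finite_permutations) auto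
  also have "\<dots> = (\<Sum>\<sigma>\<in>?P.
      (\<Prod>c\<in>directed_cycles (moved \<sigma>). w c * (\<Prod>e\<in>c. if snd e \<in> out (fst e) then a e else 0)) *
      (\<Prod>v | v \<in> V \<and> \<sigma> v = v. \<Sum>x\<in>out v. a (v, x)))"
  proof (rule sum.cong[OF refl])
    fix \<sigma> assume "\<sigma> \<in> ?P"
    then have s: "\<sigma> permutes V" by simp
    let ?S = "\<lambda>v. \<Sum>x\<in>{x\<in>out v. \<sigma> v = v \<or> \<sigma> v = x}. a (v, x)"
    let ?g = "\<lambda>e. if snd e \<in> out (fst e) then a e else 0"
    have "{f\<in>PiE V out. \<forall>v\<in>V. \<sigma> v = v \<or> \<sigma> v = f v} = PiE V (\<lambda>v. {x\<in>out v. \<sigma> v = v \<or> \<sigma> v = x})"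
      by (auto simp: PiE_iff extensional_def)
    then have "(\<Sum>f\<in>{f\<in>PiE V out. \<forall>v\<in>V. \<sigma> v = v \<or> \<sigma> v = f v}. ?W \<sigma> * (\<Prod>v\<in>V. a (v, f v))) =
      ?W \<sigma> * (\<Prod>v\<in>V. ?S v)"
      using prod_sum_PiE[of V "\<lambda>v. {x\<in>out v. \<sigma> v = v \<or> \<sigma> v = x}" "\<lambda>v x. a (v, x)"] V out
      by (simp add: sum_distrib_left)
    also have "(\<Prod>v\<in>V. ?S v) = (\<Prod>v | \<sigma> v \<noteq> v. ?S v) * (\<Prod>v | v \<in> V \<and> \<sigma> v = v. ?S v)"
      by (rule prod_moved_fixed[OF s V])
    also have "(\<Prod>v | v \<in> V \<and> \<sigma> v = v. ?S v) = (\<Prod>v | v \<in> V \<and> \<sigma> v = v. \<Sum>x\<in>out v. a (v, x))"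
      by (intro prod.cong) auto
    also have "(\<Prod>v | \<sigma> v \<noteq> v. ?S v) = (\<Prod>v | \<sigma> v \<noteq> v. ?g (v, \<sigma> v))"
    proof (rule prod.cong[OF refl])
      fix v assume "v \<in> {v. \<sigma> v \<noteq> v}"
      then have "{x\<in>out v. \<sigma> v = v \<or> \<sigma> v = x} = (if \<sigma> v \<in> out v then {\<sigma> v} else {})"
        by auto
      then show "?S v = ?g (v, \<sigma> v)" by simp
    qed
    also have "\<dots> = (\<Prod>c\<in>directed_cycles (moved \<sigma>). \<Prod>e\<in>c. ?g e)"
      by (rule prod_directed_cycles[OF permutes_imp_permutation[OF V s]])
    finally show "(\<Sum>f\<in>{f\<in>PiE V out. \<forall>v\<in>V. \<sigma> v = v \<or> \<sigma> v = f v}. ?W \<sigma> * (\<Prod>v\<in>V. a (v, f v))) =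
      (\<Prod>c\<in>directed_cycles (moved \<sigma>). w c * (\<Prod>e\<in>c. ?g e)) *
      (\<Prod>v | v \<in> V \<and> \<sigma> v = v. \<Sum>x\<in>out v. a (v, x))"
      by (simp add: prod.distrib mult.assoc)
  qed
  finally show ?thesis .
qed

text \<open>
  With as many edges as vertices in \<open>V\<close>, and one leaving each vertex of \<open>V\<close>, no edge is left to start
  elsewhere: the forests are exactly the graphs of the functions on \<open>V\<close>.
\<close>

lemma bij_betw_functions_forests:
  assumes V: "finite V" and E: "finite E"
  shows "bij_betw (\<lambda>f. (\<lambda>v. (v, f v)) ` V) (PiE V (\<lambda>v. E `` {v}))
    {F. F \<subseteq> E \<and> card F = card V \<and> (\<forall>v\<in>V. \<exists>!e. e \<in> F \<and> fst e = v)}"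
proof (rule bij_betw_imageI)
  show "inj_on (\<lambda>f. (\<lambda>v. (v, f v)) ` V) (PiE V (\<lambda>v. E `` {v}))"
  proof (rule inj_onI)
    fix f g assume fg: "f \<in> PiE V (\<lambda>v. E `` {v})" "g \<in> PiE V (\<lambda>v. E `` {v})"
      and eq: "(\<lambda>v. (v, f v)) ` V = (\<lambda>v. (v, g v)) ` V"
    show "f = g"
    proof (rule PiE_ext[OF fg])
      fix v assume "v \<in> V"
      then have "(v, f v) \<in> (\<lambda>v. (v, g v)) ` V" using eq by blast
      then show "f v = g v" by auto
    qed
  qed
  show "(\<lambda>f. (\<lambda>v. (v, f v)) ` V) ` PiE V (\<lambda>v. E `` {v}) =
    {F. F \<subseteq> E \<and> card F = card V \<and> (\<forall>v\<in>V. \<exists>!e. e \<in> F \<and> fst e = v)}"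
  proof (intro equalityI subsetI)
    fix F assume "F \<in> (\<lambda>f. (\<lambda>v. (v, f v)) ` V) ` PiE V (\<lambda>v. E `` {v})"
    then obtain f where f: "f \<in> PiE V (\<lambda>v. E `` {v})" "F = (\<lambda>v. (v, f v)) ` V" by blast
    have "card F = card V"
      unfolding f(2) by (rule card_image) (auto simp: inj_on_def)
    then show "F \<in> {F. F \<subseteq> E \<and> card F = card V \<and> (\<forall>v\<in>V. \<exists>!e. e \<in> F \<and> fst e = v)}"
      using f by (auto simp: PiE_iff)
  next
    fix F assume "F \<in> {F. F \<subseteq> E \<and> card F = card V \<and> (\<forall>v\<in>V. \<exists>!e. e \<in> F \<and> fst e = v)}"
    then have F: "F \<subseteq> E" "card F = card V" and ex: "\<forall>v\<in>V. \<exists>!e. e \<in> F \<and> fst e = v" by auto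
    from ex have "\<forall>v\<in>V. \<exists>x. (v, x) \<in> F" by (metis prod.collapse)
    then obtain f0 where f0: "\<forall>v\<in>V. (v, f0 v) \<in> F" by metis
    define f where "f = restrict f0 V"
    have sub: "(\<lambda>v. (v, f v)) ` V \<subseteq> F"
      using f0 by (auto simp: f_def)
    moreover have "card ((\<lambda>v. (v, f v)) ` V) = card F"
      unfolding F(2) by (rule card_image) (auto simp: inj_on_def)
    ultimately have "F = (\<lambda>v. (v, f v)) ` V"
      using card_subset_eq[OF finite_subset[OF F(1) E]] by metis
    moreover have "f \<in> PiE V (\<lambda>v. E `` {v})"
      using sub F(1) by (auto simp: PiE_iff f_def)
    ultimately show "F \<in> (\<lambda>f. (\<lambda>v. (v, f v)) ` V) ` PiE V (\<lambda>v. E `` {v})" by blast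
  qed
qed

section \<open>The determinant as a sum over vertex permutations\<close>

lemma traverses_loop: "traverses [v] {(v, v)}"
  by (simp add: traverses_def cycle_edges_def)

lemma directed_cycles_permutation:
  assumes "\<sigma> permutes V"
  shows "directed_cycles ((\<lambda>v. (v, \<sigma> v)) ` V) =
    directed_cycles (moved \<sigma>) \<union> (\<lambda>v. {(v, v)}) ` {v \<in> V. \<sigma> v = v}"
proof
  let ?G = "(\<lambda>v. (v, \<sigma> v)) ` V"
  have sv: "single_valued ?G"
    by (auto simp: single_valued_def)
  have sub: "moved \<sigma> \<subseteq> ?G"
    using assms by (auto simp: moved_def permutes_def)
  have loop: "{(v, v)} \<in> directed_cycles ?G" if "v \<in> V" "\<sigma> v = v" for v
    using that traverses_loop[of v] by (force simp: directed_cycles_def)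
  show "directed_cycles (moved \<sigma>) \<union> (\<lambda>v. {(v, v)}) ` {v \<in> V. \<sigma> v = v} \<subseteq> directed_cycles ?G"
    using directed_cycles_mono[OF sub] loop by auto
  show "directed_cycles ?G \<subseteq> directed_cycles (moved \<sigma>) \<union> (\<lambda>v. {(v, v)}) ` {v \<in> V. \<sigma> v = v}"
  proof
    fix c assume c: "c \<in> directed_cycles ?G"
    show "c \<in> directed_cycles (moved \<sigma>) \<union> (\<lambda>v. {(v, v)}) ` {v \<in> V. \<sigma> v = v}"
    proof (cases "c \<subseteq> moved \<sigma>")
      case True
      then show ?thesis using c by (auto simp: directed_cycles_def)
    next
      case False
      then obtain v where v: "v \<in> V" "(v, \<sigma> v) \<in> c" "\<sigma> v = v"
        using c by (fastforce simp: directed_cycles_def moved_def)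
      then have "c = {(v, v)}"
        using directed_cycles_eqI[OF sv c loop[OF v(1,3)], of v] by auto
      then show ?thesis using v by blast
    qed
  qed
qed

lemma prod_directed_cycles_permutation:
  assumes "\<sigma> permutes V" "finite V"
  shows "(\<Prod>c\<in>directed_cycles ((\<lambda>v. (v, \<sigma> v)) ` V). g c) =
    (\<Prod>c\<in>directed_cycles (moved \<sigma>). g c) * (\<Prod>v | v \<in> V \<and> \<sigma> v = v. g {(v, v)})"
proof -
  have "finite (moved \<sigma>)"
    using assms by (intro finite_subset[of "moved \<sigma>" "(\<lambda>v. (v, \<sigma> v)) ` V"]) (auto simp: moved_def permutes_def)
  moreover have "directed_cycles (moved \<sigma>) \<inter> (\<lambda>v. {(v, v)}) ` {v \<in> V. \<sigma> v = v} = {}"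
    by (auto simp: directed_cycles_def moved_def)
  ultimately show ?thesis
    unfolding directed_cycles_permutation[OF assms(1)] using assms(2)
    by (subst prod.union_disjoint) (auto simp: finite_directed_cycles prod.reindex inj_on_def)
qed

text \<open>
  The determinant written with arbitrary vertices in place of row numbers, with the sign distributed
  over the nontrivial cycles. Renaming the vertices changes the traversal that represents a cycle,
  which is why \<open>t\<close> has to be central.
\<close>

lemma det_central_relabel:
  fixes t :: "'r::monoid_mult \<Rightarrow> 's::comm_ring_1"
  assumes central: "\<And>x y. t (x * y) = t (y * x)"
    and M: "dim_row M = p" and \<phi>: "inj \<phi>" "\<phi> ` {0..<p} = V" "\<And>r. \<psi> (\<phi> r) = r"
  shows "det_central t M =
    (\<Sum>\<sigma> | \<sigma> permutes V.
      (\<Prod>c\<in>directed_cycles (moved \<sigma>). (- 1) ^ (card c - 1) * t (cycle_prod (\<lambda>(u, v). M $$ (\<psi> u, \<psi> v)) c)) *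
      (\<Prod>v | v \<in> V \<and> \<sigma> v = v. t (M $$ (\<psi> v, \<psi> v))))"
proof -
  let ?M = "\<lambda>(u, v). M $$ (\<psi> u, \<psi> v)" and ?A = "{0..<p}"
  let ?G = "\<lambda>\<sigma> V. (\<lambda>v. (v, \<sigma> v)) ` V"
  have V: "finite V" using \<phi>(2) by auto
  have injA: "inj_on \<phi> B" for B
    by (rule inj_on_subset[OF \<phi>(1)]) simp
  have bij: "bij_betw \<phi> ?A V" "bij_betw \<psi> V ?A"
  proof -
    show "bij_betw \<phi> ?A V"
      using \<phi>(2) injA by (simp add: bij_betw_def)
    show "bij_betw \<psi> V ?A"
      using \<phi>(2,3) by (intro bij_betw_byWitness[of _ \<phi>]) auto
  qed
  have cyc: "t (cycle_prod ?M (map_prod \<phi> \<phi> ` c)) = t (cycle_prod (($$) M) c)" if "traverses vs c" for vs c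
  proof -
    have "t (cycle_prod ?M (map_prod \<phi> \<phi> ` c)) = t (prod_list (map ?M (cycle_edges (map \<phi> vs))))"
      by (rule cycle_prod_traverses[of t, OF central traverses_map[OF \<phi>(1) that]])
    also have "map ?M (cycle_edges (map \<phi> vs)) = map (($$) M) (cycle_edges vs)"
      using \<phi>(3) by (auto simp: cycle_edges_map)
    also have "t (prod_list \<dots>) = t (cycle_prod (($$) M) c)"
      by (rule cycle_prod_traverses[of t, OF central that, symmetric])
    finally show ?thesis .
  qed
  have "det_central t M =
    (\<Sum>\<sigma> | \<sigma> permutes V. of_int (sign \<sigma>) * (\<Prod>c\<in>directed_cycles (?G \<sigma> V). t (cycle_prod ?M c)))"
    unfolding det_central_def M
  proof (rule sum.reindex_bij_witness[where j = "map_permutation ?A \<phi>" and i = "map_permutation V \<psi>"])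
    fix \<sigma> assume "\<sigma> \<in> {\<sigma>. \<sigma> permutes ?A}"
    then have s: "\<sigma> permutes ?A" by simp
    show "map_permutation V \<psi> (map_permutation ?A \<phi> \<sigma>) = \<sigma>"
      by (rule map_permutation_compose_inv[OF bij(1) s \<phi>(3)])
    show "map_permutation ?A \<phi> \<sigma> \<in> {\<sigma>. \<sigma> permutes V}"
      using map_permutation_permutes[OF bij(1) s] by simp
    have "?G (map_permutation ?A \<phi> \<sigma>) V = map_prod \<phi> \<phi> ` ?G \<sigma> ?A"
      unfolding \<phi>(2)[symmetric] image_image
      using \<phi>(1) by (intro image_cong) (auto simp: map_permutation_apply injA)
    then have "directed_cycles (?G (map_permutation ?A \<phi> \<sigma>) V) = (`) (map_prod \<phi> \<phi>) ` directed_cycles (?G \<sigma> ?A)"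
      using directed_cycles_map[OF \<phi>(1)] by simp
    moreover have "inj_on ((`) (map_prod \<phi> \<phi>)) B" for B
      by (rule inj_onI) (simp add: inj_image_eq_iff[OF prod.inj_map[OF \<phi>(1) \<phi>(1)]])
    ultimately have "(\<Prod>c\<in>directed_cycles (?G (map_permutation ?A \<phi> \<sigma>) V). t (cycle_prod ?M c)) =
      (\<Prod>c\<in>directed_cycles (?G \<sigma> ?A). t (cycle_prod ?M (map_prod \<phi> \<phi> ` c)))"
      by (simp add: prod.reindex)
    also have "\<dots> = (\<Prod>c\<in>directed_cycles (?G \<sigma> ?A). t (cycle_prod (($$) M) c))"
      using cyc by (intro prod.cong) (auto simp: directed_cycles_def)
    finally show "of_int (sign (map_permutation ?A \<phi> \<sigma>)) *
      (\<Prod>c\<in>directed_cycles (?G (map_permutation ?A \<phi> \<sigma>) V). t (cycle_prod ?M c)) =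
      of_int (sign \<sigma>) * (\<Prod>c\<in>directed_cycles (?G \<sigma> ?A). t (cycle_prod (($$) M) c))"
      using sign_map_permutation[of \<phi> ?A \<sigma>] bij(1) s by (simp add: bij_betw_def)
  next
    fix \<sigma> assume "\<sigma> \<in> {\<sigma>. \<sigma> permutes V}"
    then have s: "\<sigma> permutes V" by simp
    show "map_permutation ?A \<phi> (map_permutation V \<psi> \<sigma>) = \<sigma>"
      using \<phi>(2,3) by (intro map_permutation_compose_inv[OF bij(2) s]) auto
    show "map_permutation V \<psi> \<sigma> \<in> {\<sigma>. \<sigma> permutes ?A}"
      using map_permutation_permutes[OF bij(2) s] by simp
  qed
  also have "\<dots> = (\<Sum>\<sigma> | \<sigma> permutes V.
      (\<Prod>c\<in>directed_cycles (moved \<sigma>). (- 1) ^ (card c - 1) * t (cycle_prod ?M c)) *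
      (\<Prod>v | v \<in> V \<and> \<sigma> v = v. t (M $$ (\<psi> v, \<psi> v))))"
  proof (rule sum.cong[OF refl])
    fix \<sigma> assume "\<sigma> \<in> {\<sigma>. \<sigma> permutes V}"
    then have s: "\<sigma> permutes V" by simp
    have sgn: "sign \<sigma> = (\<Prod>c\<in>directed_cycles (moved \<sigma>). (- 1) ^ (card c - 1))"
      by (rule sign_directed_cycles[OF permutes_imp_permutation[OF V s]])
    have "t (cycle_prod ?M {(v, v)}) = t (M $$ (\<psi> v, \<psi> v))" for v
      using cycle_prod_traverses[of t, OF central traverses_loop[of v], of ?M] by (simp add: cycle_edges_def)
    then show "of_int (sign \<sigma>) * (\<Prod>c\<in>directed_cycles (?G \<sigma> V). t (cycle_prod ?M c)) =
      (\<Prod>c\<in>directed_cycles (moved \<sigma>). (- 1) ^ (card c - 1) * t (cycle_prod ?M c)) *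
      (\<Prod>v | v \<in> V \<and> \<sigma> v = v. t (M $$ (\<psi> v, \<psi> v)))"
      unfolding prod_directed_cycles_permutation[OF s V] sgn by (simp add: prod.distrib mult.assoc)
  qed
  finally show ?thesis .
qed

section \<open>Coefficientwise extension of a central morphism\<close>

text \<open>
  The coefficients are multiplied in the order of the list, whereas the monomials commute. Hence along
  a cycle the coefficient is the ordered product of the weights.
\<close>

lemma single_prod_list:
  "prod_list (map (\<lambda>e. Poly_Mapping.single (k e) (x e)) es) =
    Poly_Mapping.single (sum_list (map k es)) (prod_list (map x es))"
  by (induction es) (simp_all add: mult_single)

lemma central_morphism_0: "central_morphism \<tau> \<Longrightarrow> \<tau> 0 = 0"
  unfolding central_morphism_def by (metis add_cancel_right_right)

lemma lookup_extend_coeffs: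
  assumes "central_morphism \<tau>"
  shows "Poly_Mapping.lookup (extend_coeffs \<tau> p) k = \<tau> (Poly_Mapping.lookup p k)"
  by (simp add: extend_coeffs_def map.rep_eq when_def central_morphism_0[OF assms])

lemma extend_coeffs_single:
  assumes "central_morphism \<tau>"
  shows "extend_coeffs \<tau> (Poly_Mapping.single k x) = Poly_Mapping.single k (\<tau> x)"
  by (simp add: extend_coeffs_def central_morphism_0[OF assms])

lemma extend_coeffs_add:
  assumes "central_morphism \<tau>"
  shows "extend_coeffs \<tau> (p + q) = extend_coeffs \<tau> p + extend_coeffs \<tau> q"
  using assms by (intro poly_mapping_eqI) (simp add: lookup_extend_coeffs lookup_add, simp add: central_morphism_def)

lemma extend_coeffs_0 [simp]: "extend_coeffs \<tau> 0 = 0"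
  by (intro poly_mapping_eqI) (simp add: extend_coeffs_def map.rep_eq)

lemma extend_coeffs_sum:
  assumes "central_morphism \<tau>"
  shows "extend_coeffs \<tau> (\<Sum>i\<in>I. p i) = (\<Sum>i\<in>I. extend_coeffs \<tau> (p i))"
  by (induction I rule: infinite_finite_induct) (simp_all add: extend_coeffs_add[OF assms])

lemma poly_mapping_sum_induct:
  assumes "\<And>k x. P (Poly_Mapping.single k x)" "\<And>p q. P p \<Longrightarrow> P q \<Longrightarrow> P (p + q)"
  shows "P (p :: 'a \<Rightarrow>\<^sub>0 'b::ab_group_add)"
proof (induction p rule: update_induct)
  case const
  then show ?case using assms(1)[of undefined 0] by simp
next
  case (update p a b)
  have "Poly_Mapping.update a b p = p + Poly_Mapping.single a b"
    using update(1) by (intro poly_mapping_eqI) (auto simp: lookup_update lookup_add lookup_single when_def in_keys_iff)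
  then show ?case using assms update by metis
qed

text \<open>
  The monomials commute, so on products of single terms this is the centrality of \<open>\<tau>\<close>; both sides are
  additive in each factor.
\<close>

lemma extend_coeffs_central:
  assumes "central_morphism \<tau>"
  shows "extend_coeffs \<tau> (p * q) = extend_coeffs \<tau> (q * p)"
proof (induction p rule: poly_mapping_sum_induct)
  case (1 k x)
  show ?case
  proof (induction q rule: poly_mapping_sum_induct)
    case (1 l y)
    have "\<tau> (x * y) = \<tau> (y * x)"
      using assms by (simp add: central_morphism_def)
    then show ?case
      by (simp add: mult_single extend_coeffs_single[OF assms] add.commute)
  qed (simp add: algebra_simps extend_coeffs_add[OF assms])
qed (simp add: algebra_simps extend_coeffs_add[OF assms])

lemma central_morphism_sign:
  assumes "central_morphism \<tau>"
  shows "\<tau> ((- 1) ^ k * x) = (- 1) ^ k * \<tau> x"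
proof -
  have add: "\<tau> (x + y) = \<tau> x + \<tau> y" for x y
    using assms by (simp add: central_morphism_def)
  have "\<tau> (- x) = - \<tau> x" for x
    using add[of x "- x"] central_morphism_0[OF assms] by (simp add: eq_neg_iff_add_eq_0 add.commute)
  then show ?thesis by (cases "even k") simp_all
qed

section \<open>Forests and entries of the Laplacian\<close>

lemma finite_hat_edges: "finite (hat_edges n N)"
proof (rule finite_subset)
  show "hat_edges n N \<subseteq> ({0..<n} \<times> {0..<N}) \<times> ({0..<n} \<times> {0..<N})"
    by (auto simp: hat_edges_def)
qed simp

definition arc_indet :: "vert \<times> vert \<Rightarrow> 'a::zero_neq_one arc_poly" where
  "arc_indet = (\<lambda>((i, k), (j, l)). indet (i, j))"

lemma arc_indet_single: "arc_indet e =
  Poly_Mapping.single (Poly_Mapping.single (fst (fst e), fst (snd e)) 1) 1"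
  by (simp add: arc_indet_def indet_def split_beta)

lemma forest_sum_eq_function_sum:
  fixes g :: "(vert \<times> vert) set \<Rightarrow> 'k::comm_ring_1 arc_poly"
  shows "(\<Sum>F\<in>forests n m N. forest_monomial F * (\<Prod>c\<in>directed_cycles F. g c)) =
    (\<Sum>f\<in>PiE ({0..<m} \<times> {0..<N}) (\<lambda>v. hat_edges n N `` {v}).
      (\<Prod>v\<in>{0..<m} \<times> {0..<N}. arc_indet (v, f v)) *
      (\<Prod>c\<in>directed_cycles ((\<lambda>v. (v, f v)) ` ({0..<m} \<times> {0..<N})). g c))"
proof -
  let ?V = "{0..<m} \<times> {0..<N}"
  have "bij_betw (\<lambda>f. (\<lambda>v. (v, f v)) ` ?V) (PiE ?V (\<lambda>v. hat_edges n N `` {v})) (forests n m N)"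
    using bij_betw_functions_forests[of ?V "hat_edges n N"] finite_hat_edges
    by (simp add: forests_def mult.commute)
  moreover have "forest_monomial ((\<lambda>v. (v, f v)) ` ?V) = (\<Prod>v\<in>?V. arc_indet (v, f v) :: 'k arc_poly)" for f
  proof -
    have "forest_monomial F = (\<Prod>e\<in>F. arc_indet e :: 'k arc_poly)" for F
      unfolding forest_monomial_def by (intro prod.cong) (auto simp: arc_indet_def)
    then show ?thesis by (simp add: prod.reindex inj_on_def)
  qed
  ultimately show ?thesis
    using sum.reindex_bij_betw[of "\<lambda>f. (\<lambda>v. (v, f v)) ` ?V" _ "forests n m N"
        "\<lambda>F. forest_monomial F * (\<Prod>c\<in>directed_cycles F. g c)"]
    by simp
qed

lemma index_less: "i < m \<Longrightarrow> k < N \<Longrightarrow> N * i + k < N * (m::nat)"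
proof -
  assume "i < m" "k < N"
  then have "N * i + k < N * Suc i" by simp
  also have "\<dots> \<le> N * m" using \<open>i < m\<close> by (intro mult_le_mono2) simp
  finally show ?thesis .
qed

lemma laplacian_entry:
  assumes "i < m" "j < m" "k < N" "l < N" "m \<le> n"
  shows "leading_submatrix (laplacian n N h) (N * m) $$ (N * i + k, N * j + l) = laplacian_block n N h i j $$ (k, l)"
proof -
  have "N * i + k < N * n" "N * j + l < N * n"
    using assms by (auto intro!: index_less)
  then show ?thesis
    using assms by (simp add: leading_submatrix_def laplacian_def index_less div_mult_self4)
qed

lemma laplacian_entry_off_diagonal:
  assumes "u \<in> {0..<m} \<times> {0..<N}" "v \<in> {0..<m} \<times> {0..<N}" "u \<noteq> v" "m \<le> n"
  shows "leading_submatrix (laplacian n N h) (N * m) $$ (N * fst u + snd u, N * fst v + snd v) =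
    (if (u, v) \<in> hat_edges n N then - (const (hat_h h (u, v)) * arc_indet (u, v)) else 0)"
proof -
  obtain i k j l where u: "u = (i, k)" "v = (j, l)" by (metis prod.collapse)
  then show ?thesis
    using assms by (auto simp: laplacian_entry laplacian_block_def hat_edges_def hat_h_def arc_indet_def)
qed

text \<open>
  The members of \<open>hat_edges\<close> that leave \<open>(i, k)\<close> carry each indeterminate \<open>a\<^sub>i\<^sub>j\<close> exactly \<open>N\<close>
  times, once for each copy \<open>(j, l)\<close> of \<open>j\<close>. This is where the powers of \<open>N\<close> come from.
\<close>

lemma extend_coeffs_laplacian_diagonal:
  fixes \<tau> :: "'h::ring_1 \<Rightarrow> 'k::comm_ring_1"
  assumes \<tau>: "central_morphism \<tau>" "\<tau> 1 = 1" and v: "v \<in> {0..<m} \<times> {0..<N}" and mn: "m \<le> n"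
  shows "of_nat N * extend_coeffs \<tau> (leading_submatrix (laplacian n N h) (N * m) $$ (N * fst v + snd v, N * fst v + snd v)) =
    (\<Sum>x\<in>hat_edges n N `` {v}. arc_indet (v, x))"
proof -
  obtain i k where ik: "v = (i, k)" "i < m" "k < N" using v by auto
  have "leading_submatrix (laplacian n N h) (N * m) $$ (N * fst v + snd v, N * fst v + snd v) =
    (\<Sum>j\<in>{0..<n} - {i}. indet (i, j))"
    using ik mn by (simp add: laplacian_entry laplacian_block_def)
  then have e: "extend_coeffs \<tau> (leading_submatrix (laplacian n N h) (N * m) $$ (N * fst v + snd v, N * fst v + snd v)) =
    (\<Sum>j\<in>{0..<n} - {i}. indet (i, j))"
    using \<tau> by (simp add: extend_coeffs_sum indet_def extend_coeffs_single)
  have "hat_edges n N `` {v} = ({0..<n} - {i}) \<times> {0..<N}"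
    using ik mn by (auto simp: hat_edges_def)
  moreover have "(\<Sum>x\<in>({0..<n} - {i}) \<times> {0..<N}. arc_indet (v, x) :: 'k arc_poly) = of_nat N * (\<Sum>j\<in>{0..<n} - {i}. indet (i, j))"
    by (simp add: sum.cartesian_product' arc_indet_def ik sum_distrib_left)
  ultimately show ?thesis using e by simp
qed

text \<open>
  A nontrivial cycle of length \<open>r\<close> contributes \<open>(- 1) ^ (r - 1)\<close> through the signature and \<open>(- 1) ^ r\<close>
  through the off-diagonal entries, so that a single minus sign remains whatever \<open>r\<close> is: it is the
  minus sign in the factors of the forest sum.
\<close>

lemma extend_coeffs_cycle_prod:
  fixes \<tau> :: "'h::ring_1 \<Rightarrow> 'k::comm_ring_1"
  assumes \<tau>: "central_morphism \<tau>" and c: "traverses vs c"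
    and M: "\<And>e. e \<in> c \<Longrightarrow> M e = (if e \<in> E then - (const (g e) * arc_indet e) else 0)"
  shows "(- 1) ^ (card c - 1) * extend_coeffs \<tau> (cycle_prod M c) =
    - const (\<tau> (cycle_prod g c)) * (\<Prod>e\<in>c. if e \<in> E then arc_indet e else 0)"
proof -
  define ws where "ws = (SOME vs. traverses vs c)"
  have w: "traverses ws c"
    unfolding ws_def using c by (rule someI)
  note len = traverses_edges[OF w]
  let ?es = "cycle_edges ws" and ?k = "\<lambda>e::vert \<times> vert. Poly_Mapping.single (fst (fst e), fst (snd e)) (1::nat)"
  have cp: "cycle_prod M c = prod_list (map M ?es)" "cycle_prod g c = prod_list (map g ?es)"
    by (simp_all add: cycle_prod_def ws_def)
  have prod: "(\<Prod>e\<in>c. f e) = prod_list (map f ?es)" for f :: "vert \<times> vert \<Rightarrow> 'k arc_poly"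
    using prod.distinct_set_conv_list[OF len(2), of f] len(3) by simp
  show ?thesis
  proof (cases "c \<subseteq> E")
    case True
    \<comment> \<open>Only the ordered product of the weights remains under \<open>\<tau>\<close>; signs and monomials are pulled out.\<close>
    have "map M ?es = map (\<lambda>e. Poly_Mapping.single (?k e) (- g e)) ?es"
      using M True len(3) by (auto simp: const_def arc_indet_single mult_single single_uminus)
    then have "cycle_prod M c = Poly_Mapping.single (sum_list (map ?k ?es)) (prod_list (map (\<lambda>e. - g e) ?es))"
      by (simp only: cp single_prod_list)
    moreover have "prod_list (map (\<lambda>e. - g e) es) = (- 1) ^ length es * prod_list (map g es)" for es
    proof (induction es)
      case (Cons e es)
      then show ?case by (cases "even (length es)") simp_all
    qed simp
    ultimately have "extend_coeffs \<tau> (cycle_prod M c) =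
      Poly_Mapping.single (sum_list (map ?k ?es)) ((- 1) ^ card c * \<tau> (cycle_prod g c))"
      by (simp only: extend_coeffs_single[OF \<tau>] central_morphism_sign[OF \<tau>] cp len(1))
    also have "\<dots> = (- 1) ^ card c * const (\<tau> (cycle_prod g c)) * Poly_Mapping.single (sum_list (map ?k ?es)) 1"
      by (cases "even (card c)") (simp_all add: const_def mult_single single_uminus)
    also have "Poly_Mapping.single (sum_list (map ?k ?es)) 1 = (\<Prod>e\<in>c. arc_indet e :: 'k arc_poly)"
      unfolding prod arc_indet_single by (simp add: single_prod_list map_replicate_const)
    also have "\<dots> = (\<Prod>e\<in>c. if e \<in> E then arc_indet e else 0)"
      using True by (intro prod.cong) auto
    finally have "extend_coeffs \<tau> (cycle_prod M c) =
      (- 1) ^ card c * const (\<tau> (cycle_prod g c)) * (\<Prod>e\<in>c. if e \<in> E then arc_indet e else 0)" .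
    moreover have "(- 1) ^ (card c - 1) * (- 1) ^ card c = (- 1 :: 'k arc_poly)"
      using len(5) by (cases "card c") (simp_all flip: power_add)
    ultimately show ?thesis
      by (simp flip: mult.assoc)
  next
    case False
    then obtain e where e: "e \<in> c" "e \<notin> E" by blast
    have "M e = 0"
      using M[OF e(1)] e(2) by simp
    then have "0 \<in> set (map M ?es)"
      using e(1) len(3) by (metis image_eqI list.set_map)
    moreover have "prod_list xs = 0" if "0 \<in> set xs" for xs :: "'h arc_poly list"
      using that by (induction xs) auto
    ultimately have "cycle_prod M c = 0"
      unfolding cp by blast
    moreover have "(\<Prod>e\<in>c. if e \<in> E then arc_indet e else 0) = (0 :: 'k arc_poly)"
      using e len(4) by (intro prod_zero) auto
    ultimately show ?thesis by simp
  qed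
qed

section \<open>The forest expansion\<close>

theorem theorem7p1:
  fixes n m N :: nat
    and \<tau> :: "'h::ring_1 \<Rightarrow> 'k::comm_ring_1"
    and h :: "nat \<Rightarrow> nat \<Rightarrow> 'h mat"
  assumes "2 \<le> n" and "1 \<le> m" and "m \<le> n" and "1 \<le> N"
    and "central_morphism \<tau>"
    and "\<tau> 1 = 1"
    and "\<And>i j. i < n \<Longrightarrow> j < n \<Longrightarrow> i \<noteq> j \<Longrightarrow> h i j \<in> carrier_mat N N"
  shows
    "let D = det_central (extend_coeffs \<tau>) (leading_submatrix (laplacian n N h) (N * m));
         T = (\<Sum>F\<in>forests n m N.
                forest_monomial F *
                (\<Prod>c\<in>directed_cycles F.
                   1 - of_nat (N ^ card c) * const (\<tau> (cycle_prod (hat_h h) c))))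
     in of_nat (N ^ (N * m)) * D = T \<and>
        (\<forall>u. of_nat N * u = 1 \<longrightarrow> D = const (u ^ (N * m)) * T)"
proof -
  let ?V = "{0..<m} \<times> {0..<N}" and ?E = "hat_edges n N" and ?t = "extend_coeffs \<tau>"
  define M where "M = leading_submatrix (laplacian n N h) (N * m)"
  define \<phi> :: "nat \<Rightarrow> vert" where "\<phi> r = (r div N, r mod N)" for r
  define \<psi> :: "vert \<Rightarrow> nat" where "\<psi> v = N * fst v + snd v" for v
  define w :: "(vert \<times> vert) set \<Rightarrow> 'k arc_poly"
    where "w c = - (of_nat (N ^ card c) * const (\<tau> (cycle_prod (hat_h h) c)))" for c
  define D where "D = det_central ?t M"
  define T where "T = (\<Sum>F\<in>forests n m N. forest_monomial F *
    (\<Prod>c\<in>directed_cycles F. 1 - of_nat (N ^ card c) * const (\<tau> (cycle_prod (hat_h h) c))))"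
  \<comment> \<open>Division with remainder by \<open>N\<close> identifies the row numbers with the vertices outside the well.\<close>
  have \<psi>\<phi>: "\<psi> (\<phi> r) = r" for r
    by (simp add: \<phi>_def \<psi>_def)
  have \<phi>: "inj \<phi>" "\<phi> ` {0..<N * m} = ?V"
  proof -
    show "inj \<phi>" by (rule inj_on_inverseI) (rule \<psi>\<phi>)
    show "\<phi> ` {0..<N * m} = ?V"
    proof (intro equalityI subsetI)
      fix v assume "v \<in> \<phi> ` {0..<N * m}"
      then obtain r where "r < N * m" "v = \<phi> r" by auto
      then show "v \<in> ?V"
        using \<open>1 \<le> N\<close> by (auto simp: \<phi>_def less_mult_imp_div_less mult.commute)
    next
      fix v assume "v \<in> ?V"
      then have "\<psi> v < N * m" "\<phi> (\<psi> v) = v"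
        by (auto simp: \<psi>_def \<phi>_def index_less)
      then show "v \<in> \<phi> ` {0..<N * m}" by force
    qed
  qed
  have dim: "dim_row M = N * m"
    by (simp add: M_def leading_submatrix_def)
  have "T = (\<Sum>f\<in>PiE ?V (\<lambda>v. ?E `` {v}). (\<Prod>v\<in>?V. arc_indet (v, f v)) *
      (\<Prod>c\<in>directed_cycles ((\<lambda>v. (v, f v)) ` ?V). 1 + w c))"
    unfolding T_def w_def using forest_sum_eq_function_sum by simp
  also have "\<dots> = (\<Sum>\<sigma> | \<sigma> permutes ?V.
      (\<Prod>c\<in>directed_cycles (moved \<sigma>). w c * (\<Prod>e\<in>c. if snd e \<in> ?E `` {fst e} then arc_indet e else 0)) *
      (\<Prod>v | v \<in> ?V \<and> \<sigma> v = v. \<Sum>x\<in>?E `` {v}. arc_indet (v, x)))"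
  proof (rule sum_functions_eq_sum_permutations)
    show "finite (?E `` {v})" for v
      by (rule finite_Image[OF finite_hat_edges])
    show "v \<notin> ?E `` {v}" for v
      by (auto simp: hat_edges_def)
  qed simp
  also have "\<dots> = (\<Sum>\<sigma> | \<sigma> permutes ?V. of_nat (N ^ (N * m)) *
      ((\<Prod>c\<in>directed_cycles (moved \<sigma>). (- 1) ^ (card c - 1) * ?t (cycle_prod (\<lambda>(u, v). M $$ (\<psi> u, \<psi> v)) c)) *
      (\<Prod>v | v \<in> ?V \<and> \<sigma> v = v. ?t (M $$ (\<psi> v, \<psi> v)))))"
  proof (rule sum.cong[OF refl])
    fix \<sigma> assume "\<sigma> \<in> {\<sigma>. \<sigma> permutes ?V}"
    then have s: "\<sigma> permutes ?V" by simp
    have sub: "u \<in> ?V" "\<sigma> u \<in> ?V" "v = \<sigma> u" "u \<noteq> v" if "(u, v) \<in> moved \<sigma>" for u v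
      using that s permutes_in_image[OF s, of u] by (auto simp: moved_def permutes_def)
    let ?C = "directed_cycles (moved \<sigma>)" and ?Fix = "{v. v \<in> ?V \<and> \<sigma> v = v}"
    \<comment> \<open>The factor \<open>N ^ (N * m)\<close> is shared out, one \<open>N\<close> per vertex: a cycle absorbs \<open>N\<close> to the power of
      its length, a fixed point turns its diagonal entry into the sum over its outgoing edges.\<close>
    have cyc: "w c * (\<Prod>e\<in>c. if snd e \<in> ?E `` {fst e} then arc_indet e else 0) =
      of_nat (N ^ card c) * ((- 1) ^ (card c - 1) * ?t (cycle_prod (\<lambda>(u, v). M $$ (\<psi> u, \<psi> v)) c))"
      if c: "c \<in> ?C" for c
    proof -
      obtain vs where vs: "traverses vs c" "c \<subseteq> moved \<sigma>"
        using c by (auto simp: directed_cycles_def)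
      have "(case e of (u, v) \<Rightarrow> M $$ (\<psi> u, \<psi> v)) = (if e \<in> ?E then - (const (hat_h h e) * arc_indet e) else 0)"
        if e: "e \<in> c" for e
      proof -
        obtain u v where uv: "e = (u, v)" "(u, v) \<in> moved \<sigma>" using e vs(2) by (metis prod.collapse subsetD)
        then show ?thesis
          using laplacian_entry_off_diagonal[of u m N v n h] sub[OF uv(2)] \<open>m \<le> n\<close>
          by (simp add: M_def \<psi>_def)
      qed
      from extend_coeffs_cycle_prod[OF \<open>central_morphism \<tau>\<close> vs(1) this]
      show ?thesis by (simp add: w_def mult.assoc)
    qed
    have "N ^ (N * m) = (\<Prod>v\<in>?V. N)"
      by (simp add: mult.commute)
    also have "\<dots> = (\<Prod>c\<in>?C. N ^ card c) * (\<Prod>v\<in>?Fix. N)"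
      using prod_moved_fixed[OF s _, of "\<lambda>_. N"] prod_directed_cycles[OF permutes_imp_permutation[OF _ s], of "\<lambda>_. N"]
      by simp
    finally have "N ^ (N * m) = (\<Prod>c\<in>?C. N ^ card c) * (\<Prod>v\<in>?Fix. N)" .
    then have pow: "(of_nat (N ^ (N * m)) :: 'k arc_poly) =
      (\<Prod>c\<in>?C. of_nat (N ^ card c)) * (\<Prod>v\<in>?Fix. of_nat N)"
      by (simp only: of_nat_mult of_nat_prod)
    have "(\<Prod>v\<in>?Fix. \<Sum>x\<in>?E `` {v}. arc_indet (v, x)) = (\<Prod>v\<in>?Fix. of_nat N * ?t (M $$ (\<psi> v, \<psi> v)))"
      unfolding M_def \<psi>_def
      using extend_coeffs_laplacian_diagonal[OF assms(5,6) _ assms(3)] by (intro prod.cong) auto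
    then show "(\<Prod>c\<in>?C. w c * (\<Prod>e\<in>c. if snd e \<in> ?E `` {fst e} then arc_indet e else 0)) *
      (\<Prod>v\<in>?Fix. \<Sum>x\<in>?E `` {v}. arc_indet (v, x)) = of_nat (N ^ (N * m)) *
      ((\<Prod>c\<in>?C. (- 1) ^ (card c - 1) * ?t (cycle_prod (\<lambda>(u, v). M $$ (\<psi> u, \<psi> v)) c)) *
      (\<Prod>v\<in>?Fix. ?t (M $$ (\<psi> v, \<psi> v))))"
      unfolding pow using cyc by (simp add: prod.distrib mult_ac)
  qed
  also have "\<dots> = of_nat (N ^ (N * m)) * D"
    unfolding D_def det_central_relabel[of ?t, OF extend_coeffs_central[OF assms(5)] dim \<phi> \<psi>\<phi>]
    by (simp add: sum_distrib_left)
  finally have main: "of_nat (N ^ (N * m)) * D = T" by simp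
  moreover have "D = const (u ^ (N * m)) * T" if u: "of_nat N * u = 1" for u
  proof -
    have "const (u ^ (N * m)) * of_nat (N ^ (N * m)) = const ((of_nat N * u) ^ (N * m))"
      by (simp add: const_def mult_single power_mult_distrib mult.commute flip: single_of_nat)
    also have "\<dots> = 1"
      by (simp add: u const_def)
    finally show ?thesis
      unfolding main[symmetric] by (simp flip: mult.assoc)
  qed
  ultimately show ?thesis
    unfolding D_def M_def T_def Let_def by blast
qed

end
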